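(* For every integer $n\ge 3$, there are infinitely many $z$-classes in the palindromic automorphism group $\Pi A(F_n)$.
   Context: For a group $G$, two elements $x,y\in G$ are $z$-equivalent if their centralizers $Z_G(x)$ and $Z_G(y)$ are conjugate subgroups of $G$; the equivalence classes are called the $z$-classes of $G$. $F_n$ is the free group with free generating set $S=\{a_1,\dots,a_n\}$. For a reduced word $w=x_1x_2\cdots x_k$ with letters $x_i\in S\cup S^{-1}$, let $\bar w=x_k\cdots x_2x_1$. A reduced word $w$ is palindromic if $w=\bar w$. A palindromic automorphism of $F_n$ is an automorphism of $F_n$ that maps each generator $a_i$ to a palindromic word. The collection of all palindromic automorphisms is a subgroup of $\mathrm{Aut}(F_n)$, denoted $\Pi A(F_n)$. *)

theory Defs
  imports "HOL-Algebra.Group_Action"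
begin

section \<open>The z-classes of a group\<close>

definition centralizer :: "('a, 'b) monoid_scheme \<Rightarrow> 'a \<Rightarrow> 'a set" where
  "centralizer G x = {g \<in> carrier G. g \<otimes>\<^bsub>G\<^esub> x = x \<otimes>\<^bsub>G\<^esub> g}"

definition conjugate_in :: "('a, 'b) monoid_scheme \<Rightarrow> 'a set \<Rightarrow> 'a set \<Rightarrow> bool" where
  "conjugate_in G H K \<longleftrightarrow> (\<exists>g \<in> carrier G. K = g <#\<^bsub>G\<^esub> H #>\<^bsub>G\<^esub> (inv\<^bsub>G\<^esub> g))"

definition z_equivalence :: "('a, 'b) monoid_scheme \<Rightarrow> ('a \<times> 'a) set" where
  "z_equivalence G = {(x, y). x \<in> carrier G \<and> y \<in> carrier G \<and>
     conjugate_in G (centralizer G x) (centralizer G y)}"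

definition z_classes :: "('a, 'b) monoid_scheme \<Rightarrow> 'a set set" where
  "z_classes G = carrier G // z_equivalence G"

lemma (in group) centralizer_subgroup:
  assumes "x \<in> carrier G"
  shows "subgroup (centralizer G x) G"
proof (rule subgroupI)
  show "centralizer G x \<subseteq> carrier G" "centralizer G x \<noteq> {}"
    using assms by (auto simp: centralizer_def intro!: exI[of _ \<one>])
  fix a assume a: "a \<in> centralizer G x"
  then show "inv a \<in> centralizer G x"
    using assms by (auto simp: centralizer_def) (metis inv_closed inv_solve_left inv_solve_right m_assoc m_closed)
  fix b assume b: "b \<in> centralizer G x"
  show "a \<otimes> b \<in> centralizer G x"
    using a b assms by (auto simp: centralizer_def) (metis m_assoc)
qed

lemma (in group) equiv_z_equivalence: "equiv (carrier G) (z_equivalence G)"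
proof (rule equivI)
  have sub: "centralizer G x \<subseteq> carrier G" for x
    by (auto simp: centralizer_def)
  show "z_equivalence G \<subseteq> carrier G \<times> carrier G"
    by (auto simp: z_equivalence_def)
  show "refl_on (carrier G) (z_equivalence G)"
    using sub by (auto simp: refl_on_def z_equivalence_def conjugate_in_def lcos_mult_one coset_mult_one
        intro!: bexI[of _ \<one>])
  show "sym (z_equivalence G)"
  proof (rule symI)
    fix x y assume "(x, y) \<in> z_equivalence G"
    then obtain g where g: "g \<in> carrier G" "x \<in> carrier G" "y \<in> carrier G"
      "centralizer G y = g <# centralizer G x #> inv g"
      by (auto simp: z_equivalence_def conjugate_in_def)
    have "inv g <# (g <# centralizer G x #> inv g) #> inv (inv g) = centralizer G x"
      using g(1) sub[of x]
      by (simp add: lcos_m_assoc coset_assoc l_coset_subset_G coset_mult_assoc lcos_mult_one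
          coset_mult_one r_coset_subset_G flip: coset_assoc)
    then show "(y, x) \<in> z_equivalence G"
      using g by (auto simp: z_equivalence_def conjugate_in_def intro!: bexI[of _ "inv g"])
  qed
  show "trans (z_equivalence G)"
  proof (rule transI)
    fix x y z assume "(x, y) \<in> z_equivalence G" "(y, z) \<in> z_equivalence G"
    then obtain g h where g: "g \<in> carrier G" "h \<in> carrier G" "x \<in> carrier G" "z \<in> carrier G"
      "centralizer G z = h <# (g <# centralizer G x #> inv g) #> inv h"
      by (auto simp: z_equivalence_def conjugate_in_def)
    have "h <# (g <# centralizer G x #> inv g) #> inv h
        = (h \<otimes> g) <# centralizer G x #> inv (h \<otimes> g)"
      using g(1,2) sub[of x]
      by (simp add: lcos_m_assoc l_coset_subset_G coset_mult_assoc inv_mult_group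
          r_coset_subset_G flip: coset_assoc)
    then show "(x, z) \<in> z_equivalence G"
      using g by (auto simp: z_equivalence_def conjugate_in_def intro!: bexI[of _ "h \<otimes> g"])
  qed
qed


section \<open>The free group of rank n, as reduced words\<close>

text \<open>The letter \<open>(i, True)\<close> stands for the generator \<open>a\<^sub>i\<close>, and \<open>(i, False)\<close> for its inverse.\<close>

type_synonym letter = "nat \<times> bool"

definition inv_letter :: "letter \<Rightarrow> letter" where
  "inv_letter x = (fst x, \<not> snd x)"

definition reduced :: "letter list \<Rightarrow> bool" where
  "reduced w \<longleftrightarrow> successively (\<lambda>x y. y \<noteq> inv_letter x) w"

definition cons_reduce :: "letter \<Rightarrow> letter list \<Rightarrow> letter list" where
  "cons_reduce x w = (if w \<noteq> [] \<and> hd w = inv_letter x then tl w else x # w)"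

definition reduce :: "letter list \<Rightarrow> letter list" where
  "reduce w = foldr cons_reduce w []"

definition free_group :: "nat \<Rightarrow> letter list monoid" where
  "free_group n =
    \<lparr>carrier = {w. set w \<subseteq> {1..n} \<times> UNIV \<and> reduced w},
     mult = \<lambda>u v. reduce (u @ v),
     one = []\<rparr>"

definition gen :: "nat \<Rightarrow> letter list" where
  "gen i = [(i, True)]"

lemma inv_letter_invol [simp]: "inv_letter (inv_letter x) = x"
  by (simp add: inv_letter_def)

lemma inv_letter_neq [simp]: "inv_letter x \<noteq> x" "x \<noteq> inv_letter x"
  by (auto simp: inv_letter_def prod_eq_iff)

lemma reduced_simps [simp]:
  "reduced []"
  "reduced (x # w) \<longleftrightarrow> reduced w \<and> (w \<noteq> [] \<longrightarrow> hd w \<noteq> inv_letter x)"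
  by (auto simp: reduced_def successively_Cons)

lemma reduced_append:
  "reduced (u @ v) \<longleftrightarrow>
    reduced u \<and> reduced v \<and> (u \<noteq> [] \<longrightarrow> v \<noteq> [] \<longrightarrow> hd v \<noteq> inv_letter (last u))"
  by (auto simp: reduced_def successively_append_iff)

lemma reduced_rev [simp]: "reduced (rev w) \<longleftrightarrow> reduced w"
proof -
  have *: "reduced w \<Longrightarrow> reduced (rev w)" for w
    by (induction w) (auto simp: reduced_append last_rev)
  from *[of w] *[of "rev w"] show ?thesis by auto
qed

lemma reduced_cons_reduce [simp]: "reduced w \<Longrightarrow> reduced (cons_reduce x w)"
  by (cases w) (auto simp: cons_reduce_def)

lemma reduced_foldr [simp]: "reduced v \<Longrightarrow> reduced (foldr cons_reduce u v)"
  by (induction u) auto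

lemma reduced_reduce [simp]: "reduced (reduce w)"
  by (simp add: reduce_def)

lemma reduce_id [simp]: "reduced w \<Longrightarrow> reduce w = w"
  unfolding reduce_def by (induction w) (auto simp: cons_reduce_def)

lemma set_cons_reduce: "set (cons_reduce x w) \<subseteq> insert x (set w)"
  by (cases w) (auto simp: cons_reduce_def)

lemma set_reduce: "set (reduce w) \<subseteq> set w"
  unfolding reduce_def using set_cons_reduce by (induction w) fastforce+

lemma cons_reduce_cancel [simp]:
  "reduced w \<Longrightarrow> cons_reduce x (cons_reduce (inv_letter x) w) = w"
  by (cases w; cases "tl w") (auto simp: cons_reduce_def)

lemma reduce_append: "reduce (u @ v) = foldr cons_reduce u (reduce v)"
  by (simp add: reduce_def)

lemma foldr_cons_reduce:
  assumes "reduced v" "reduced w"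
  shows "foldr cons_reduce (cons_reduce x v) w = cons_reduce x (foldr cons_reduce v w)"
proof (cases "v \<noteq> [] \<and> hd v = inv_letter x")
  case True
  then obtain v' where "v = inv_letter x # v'"
    by (cases v) auto
  with assms show ?thesis
    by (simp add: cons_reduce_def[of x "inv_letter x # v'"])
qed (auto simp: cons_reduce_def[of x v])

lemma foldr_reduce: "reduced w \<Longrightarrow> foldr cons_reduce (reduce u) w = foldr cons_reduce u w"
proof (induction u)
  case (Cons x u)
  then show ?case
    using foldr_cons_reduce[of "reduce u" w x] by (simp add: reduce_def)
qed (simp add: reduce_def)

lemma reduce_append_reduce [simp]:
  "reduce (reduce u @ v) = reduce (u @ v)"
  "reduce (u @ reduce v) = reduce (u @ v)"
  by (simp_all add: reduce_append foldr_reduce)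

lemma reduce_inv_cancel: "reduce (map inv_letter (rev w) @ w) = []"
proof (induction w)
  case (Cons x w)
  have "reduce (map inv_letter (rev (x # w)) @ x # w) =
      foldr cons_reduce (map inv_letter (rev w)) (reduce (inv_letter x # x # w))"
    by (simp add: reduce_append)
  also have "reduce (inv_letter x # x # w) = reduce w"
    using cons_reduce_cancel[of "reduce w" "inv_letter x"] by (simp add: reduce_def)
  finally show ?case
    using Cons by (simp add: reduce_append)
qed simp

lemma rev_reduce: "reduce (rev w) = rev (reduce w)"
proof (induction w)
  case (Cons x w)
  have "reduce (rev (x # w)) = reduce (rev (reduce w) @ [x])"
    using reduce_append_reduce(1)[of "rev w" "[x]"] Cons by simp
  also have "\<dots> = rev (cons_reduce x (reduce w))"
  proof (cases "reduce w \<noteq> [] \<and> hd (reduce w) = inv_letter x")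
    case True
    then obtain s where s: "reduce w = inv_letter x # s"
      by (cases "reduce w") auto
    then have "reduced s"
      using reduced_reduce[of w] by simp
    moreover have "reduce [inv_letter x, x] = []"
      by (simp add: reduce_def cons_reduce_def)
    ultimately show ?thesis
      using s by (simp add: reduce_append) (simp add: cons_reduce_def flip: reduce_def)
  next
    case False
    then have "reduced (x # reduce w)" by auto
    then have "reduced (rev (x # reduce w))" by (simp only: reduced_rev)
    with False show ?thesis
      by (auto simp: cons_reduce_def)
  qed
  also have "\<dots> = rev (reduce (x # w))"
    by (simp add: reduce_def)
  finally show ?case .
qed simp

lemma group_free_group: "group (free_group n)"
proof (rule groupI)
  fix x y assume "x \<in> carrier (free_group n)" "y \<in> carrier (free_group n)"
  then show "x \<otimes>\<^bsub>free_group n\<^esub> y \<in> carrier (free_group n)"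
    using set_reduce[of "x @ y"] by (auto simp: free_group_def)
next
  fix x assume x: "x \<in> carrier (free_group n)"
  let ?y = "reduce (map inv_letter (rev x))"
  have "set (map inv_letter (rev x)) \<subseteq> {1..n} \<times> UNIV"
    using x by (auto simp: free_group_def inv_letter_def)
  then have "set ?y \<subseteq> {1..n} \<times> UNIV"
    using set_reduce by blast
  then show "\<exists>y\<in>carrier (free_group n). y \<otimes>\<^bsub>free_group n\<^esub> x = \<one>\<^bsub>free_group n\<^esub>"
    by (intro bexI[of _ ?y]) (auto simp: free_group_def reduce_inv_cancel)
qed (auto simp: free_group_def)

lemma gen_in_free_group: "i \<in> {1..n} \<Longrightarrow> gen i \<in> carrier (free_group n)"
  by (simp add: gen_def free_group_def)

text \<open>The universal property: \<open>a\<^sub>1, \<dots>, a\<^sub>n\<close> freely generate \<^term>\<open>free_group n\<close>.\<close>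

lemma free_group_hom_unique:
  assumes H: "group H" and f: "f \<in> hom (free_group n) H" and g: "g \<in> hom (free_group n) H"
    and eq: "\<And>i. i \<in> {1..n} \<Longrightarrow> f (gen i) = g (gen i)"
    and w: "w \<in> carrier (free_group n)"
  shows "f w = g w"
proof -
  interpret F: group "free_group n" by (rule group_free_group)
  interpret f: group_hom "free_group n" H f
    using H f by (simp add: group_hom_def group_hom_axioms_def F.is_group)
  interpret g: group_hom "free_group n" H g
    using H g by (simp add: group_hom_def group_hom_axioms_def F.is_group)
  have letter: "f [x] = g [x]" if "[x] \<in> carrier (free_group n)" for x
  proof -
    obtain i b where x: "x = (i, b)" by fastforce
    have i: "i \<in> {1..n}" using that x by (auto simp: free_group_def)
    show ?thesis
    proof (cases b)
      case True then show ?thesis using eq[OF i] x by (simp add: gen_def)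
    next
      case False
      have "[x] \<otimes>\<^bsub>free_group n\<^esub> gen i = \<one>\<^bsub>free_group n\<^esub>"
        using x False by (simp add: free_group_def gen_def reduce_def cons_reduce_def inv_letter_def)
      then have "[x] = inv\<^bsub>free_group n\<^esub> gen i"
        using F.inv_equality[OF _ gen_in_free_group[OF i] that] by simp
      then show ?thesis
        using eq[OF i] gen_in_free_group[OF i] by simp
    qed
  qed
  show ?thesis using w
  proof (induction w)
    case Nil
    then show ?case using f.hom_one g.hom_one by (simp add: free_group_def)
  next
    case (Cons x w)
    have x: "[x] \<in> carrier (free_group n)" and w: "w \<in> carrier (free_group n)"
      using Cons.prems by (auto simp: free_group_def)
    have "x # w = [x] \<otimes>\<^bsub>free_group n\<^esub> w"
      using Cons.prems by (simp add: free_group_def)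
    then show ?case
      using letter[OF x] Cons.IH[OF w] f.hom_mult[OF x w] g.hom_mult[OF x w] by simp
  qed
qed

definition letter_map :: "('a, 'b) monoid_scheme \<Rightarrow> (nat \<Rightarrow> 'a) \<Rightarrow> letter \<Rightarrow> 'a" where
  "letter_map H f x = (if snd x then f (fst x) else inv\<^bsub>H\<^esub> f (fst x))"

definition word_map :: "('a, 'b) monoid_scheme \<Rightarrow> (nat \<Rightarrow> 'a) \<Rightarrow> letter list \<Rightarrow> 'a" where
  "word_map H f w = foldr (\<lambda>x y. letter_map H f x \<otimes>\<^bsub>H\<^esub> y) w \<one>\<^bsub>H\<^esub>"

lemma free_group_hom_exists:
  assumes H: "group H" and f: "\<And>i. i \<in> {1..n} \<Longrightarrow> f i \<in> carrier H"
  shows "word_map H f \<in> hom (free_group n) H"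
    and "i \<in> {1..n} \<Longrightarrow> word_map H f (gen i) = f i"
proof -
  interpret H: group H by (rule H)
  have letter: "letter_map H f x \<in> carrier H" if "x \<in> {1..n} \<times> UNIV" for x
    using that f by (auto simp: letter_map_def)
  have closed: "word_map H f w \<in> carrier H" if "set w \<subseteq> {1..n} \<times> UNIV" for w
    using that letter by (induction w) (auto simp: word_map_def)
  have append: "word_map H f (u @ v) = word_map H f u \<otimes>\<^bsub>H\<^esub> word_map H f v"
    if "set u \<subseteq> {1..n} \<times> UNIV" "set v \<subseteq> {1..n} \<times> UNIV" for u v
    using that(1)
  proof (induction u)
    case Nil
    then show ?case using closed[OF that(2)] by (simp add: word_map_def)
  next
    case (Cons x u)
    then have "x \<in> {1..n} \<times> UNIV" "set u \<subseteq> {1..n} \<times> UNIV" by auto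
    then show ?case
      using Cons.IH letter closed[OF that(2)] closed[of u] by (simp add: word_map_def H.m_assoc)
  qed
  have cons: "word_map H f (cons_reduce x w) = letter_map H f x \<otimes>\<^bsub>H\<^esub> word_map H f w"
    if "x \<in> {1..n} \<times> UNIV" "set w \<subseteq> {1..n} \<times> UNIV" for x w
  proof (cases "w \<noteq> [] \<and> hd w = inv_letter x")
    case True
    then obtain v where w: "w = inv_letter x # v" by (cases w) auto
    have "letter_map H f x \<otimes>\<^bsub>H\<^esub> letter_map H f (inv_letter x) = \<one>\<^bsub>H\<^esub>"
      using f that(1) by (auto simp: letter_map_def inv_letter_def)
    moreover have "letter_map H f (inv_letter x) \<in> carrier H"
      using that w letter by simp
    ultimately show ?thesis
      using that w closed[of v] letter[OF that(1)]
      by (simp add: cons_reduce_def word_map_def H.m_assoc[symmetric])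
  qed (auto simp: cons_reduce_def word_map_def)
  have reduce: "word_map H f (reduce w) = word_map H f w" if "set w \<subseteq> {1..n} \<times> UNIV" for w
    using that
  proof (induction w)
    case (Cons x w)
    then have "set (reduce w) \<subseteq> {1..n} \<times> UNIV"
      using set_reduce[of w] by auto
    then show ?case
      using Cons cons[of x "reduce w"] by (simp add: reduce_def word_map_def)
  qed simp
  show "word_map H f \<in> hom (free_group n) H"
    using closed append reduce by (auto simp: hom_def free_group_def)
  show "i \<in> {1..n} \<Longrightarrow> word_map H f (gen i) = f i"
    using f by (simp add: word_map_def gen_def letter_map_def)
qed


section \<open>The palindromic automorphism group\<close>

definition palindromic :: "letter list \<Rightarrow> bool" where
  "palindromic w \<longleftrightarrow> reduced w \<and> rev w = w"

definition palindromic_auto :: "nat \<Rightarrow> (letter list \<Rightarrow> letter list) set" where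
  "palindromic_auto n = {\<phi> \<in> auto (free_group n). \<forall>i \<in> {1..n}. palindromic (\<phi> (gen i))}"

definition palindromic_AutoGroup :: "nat \<Rightarrow> (letter list \<Rightarrow> letter list) monoid" where
  "palindromic_AutoGroup n = AutoGroup (free_group n) \<lparr>carrier := palindromic_auto n\<rparr>"

lemma rev_free_group_mult:
  "rev (u \<otimes>\<^bsub>free_group n\<^esub> v) = rev v \<otimes>\<^bsub>free_group n\<^esub> rev u"
  by (simp add: free_group_def flip: rev_reduce)

lemma rev_in_free_group [simp]: "rev w \<in> carrier (free_group n) \<longleftrightarrow> w \<in> carrier (free_group n)"
  by (simp add: free_group_def)

lemma palindromic_auto_iff:
  "\<phi> \<in> palindromic_auto n \<longleftrightarrow>
    \<phi> \<in> auto (free_group n) \<and> (\<forall>w \<in> carrier (free_group n). \<phi> (rev w) = rev (\<phi> w))"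
proof safe
  assume p: "\<phi> \<in> palindromic_auto n"
  then show a: "\<phi> \<in> auto (free_group n)" by (simp add: palindromic_auto_def)
  then have hom: "\<phi> \<in> hom (free_group n) (free_group n)" by (simp add: auto_def)
  then have "(\<lambda>w. rev (\<phi> (rev w))) \<in> hom (free_group n) (free_group n)"
    unfolding hom_def by (auto simp: rev_free_group_mult)
  moreover have "rev (\<phi> (rev (gen i))) = \<phi> (gen i)" if "i \<in> {1..n}" for i
    using p that by (auto simp: palindromic_auto_def palindromic_def gen_def)
  ultimately have *: "rev (\<phi> (rev w)) = \<phi> w" if "w \<in> carrier (free_group n)" for w
    using free_group_hom_unique[OF group_free_group _ hom _ that] by blast
  fix w assume "w \<in> carrier (free_group n)"
  then show "\<phi> (rev w) = rev (\<phi> w)" using *[of w] by (metis rev_rev_ident)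
next
  assume a: "\<phi> \<in> auto (free_group n)"
    and r: "\<forall>w \<in> carrier (free_group n). \<phi> (rev w) = rev (\<phi> w)"
  have "palindromic (\<phi> (gen i))" if "i \<in> {1..n}" for i
  proof -
    have "\<phi> (gen i) \<in> carrier (free_group n)"
      using a gen_in_free_group[OF that] by (auto simp: auto_def hom_def)
    moreover have "rev (gen i) = gen i" by (simp add: gen_def)
    ultimately show ?thesis
      using r gen_in_free_group[OF that] unfolding palindromic_def
      by (metis (mono_tags, lifting) free_group_def mem_Collect_eq partial_object.select_convs(1))
  qed
  with a show "\<phi> \<in> palindromic_auto n" by (simp add: palindromic_auto_def)
qed

lemma subgroup_palindromic_auto: "subgroup (palindromic_auto n) (AutoGroup (free_group n))"
proof -
  let ?F = "free_group n" and ?A = "AutoGroup (free_group n)"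
  interpret F: group ?F by (rule group_free_group)
  interpret A: group ?A by (rule F.AutoGroup)
  have carr: "carrier ?A = auto ?F" by (simp add: AutoGroup_def)
  have mult: "f \<otimes>\<^bsub>?A\<^esub> g = compose (carrier ?F) f g" if "f \<in> auto ?F" "g \<in> auto ?F" for f g
    using that by (simp add: AutoGroup_def BijGroup_def auto_def)
  have one: "\<one>\<^bsub>?A\<^esub> = (\<lambda>x\<in>carrier ?F. x)"
    by (simp add: AutoGroup_def BijGroup_def)
  have closed: "f w \<in> carrier ?F" if "f \<in> auto ?F" "w \<in> carrier ?F" for f w
    using that by (auto simp: auto_def hom_def)
  show ?thesis
  proof (rule A.subgroupI)
    show "palindromic_auto n \<subseteq> carrier ?A"
      by (auto simp: palindromic_auto_def carr)
    have "\<one>\<^bsub>?A\<^esub> \<in> palindromic_auto n"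
      using A.one_closed by (simp add: palindromic_auto_iff carr) (simp add: one)
    then show "palindromic_auto n \<noteq> {}" by blast
    fix f assume f: "f \<in> palindromic_auto n"
    then have fa: "f \<in> auto ?F" by (simp add: palindromic_auto_def)
    have ia: "inv\<^bsub>?A\<^esub> f \<in> auto ?F"
      using A.inv_closed[of f] fa by (simp add: carr)
    have fi: "f ((inv\<^bsub>?A\<^esub> f) w) = w" "(inv\<^bsub>?A\<^esub> f) (f w) = w" if "w \<in> carrier ?F" for w
      using A.r_inv[of f] A.l_inv[of f] fa ia that
      by (simp_all add: carr mult one compose_def restrict_def fun_eq_iff) metis+
    have "(inv\<^bsub>?A\<^esub> f) (rev w) = rev ((inv\<^bsub>?A\<^esub> f) w)" if w: "w \<in> carrier ?F" for w
    proof -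
      have "rev w = rev (f ((inv\<^bsub>?A\<^esub> f) w))" using fi w by simp
      also have "\<dots> = f (rev ((inv\<^bsub>?A\<^esub> f) w))"
        using f closed[OF ia w] by (simp add: palindromic_auto_iff)
      finally show ?thesis using fi(2) closed[OF ia w] by simp
    qed
    with ia show "inv\<^bsub>?A\<^esub> f \<in> palindromic_auto n" by (simp add: palindromic_auto_iff)
    fix g assume g: "g \<in> palindromic_auto n"
    then have ga: "g \<in> auto ?F" by (simp add: palindromic_auto_def)
    show "f \<otimes>\<^bsub>?A\<^esub> g \<in> palindromic_auto n"
      using f g fa ga closed[OF ga] A.m_closed[of f g]
      by (simp add: palindromic_auto_iff carr mult compose_def)
  qed
qed

lemma group_palindromic_AutoGroup: "group (palindromic_AutoGroup n)"
  unfolding palindromic_AutoGroup_def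
  using subgroup.subgroup_is_group[OF subgroup_palindromic_auto group.AutoGroup[OF group_free_group]] .

end

(*
  If x and y are z-equivalent, some conjugate b of x commutes with the whole centralizer of y.
  Take x_p = alpha^p beta with alpha: a_1 -> a_2 a_1 a_2 and beta: a_2 -> a_1 a_2 a_1, which on the
  abelianization is the block [[1, 2], [2p, 4p+1]] on a_1, a_2. The inversions of a_3, ..., a_n
  centralize x_p, so if b is conjugate to x_q and commutes with the centralizer of x_p, then on the
  abelianization b^2 is the identity outside a 2x2 block that commutes with the block of x_p. Hence
  its discriminant is 4p(p+1) times a square, while comparing traces of b^2 and b^4 with those of
  x_q^2 and x_q^4 shows that it is q(q+1) times a nonzero square. For odd primes p < q this is impossible
  by the q-adic valuation, so the x_p lie in pairwise distinct z-classes.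
*)

theory Submission
  imports Defs "HOL-Algebra.Elementary_Groups" "HOL-Computational_Algebra.Primes"
begin

section \<open>Automorphisms given by the images of the generators\<close>

lemma inv_gen:
  assumes "i \<in> {1..n}"
  shows "inv\<^bsub>free_group n\<^esub> gen i = [(i, False)]"
proof -
  interpret F: group "free_group n" by (rule group_free_group)
  have "[(i, False)] \<otimes>\<^bsub>free_group n\<^esub> gen i = \<one>\<^bsub>free_group n\<^esub>"
    by (simp add: free_group_def gen_def reduce_def cons_reduce_def inv_letter_def)
  moreover have "[(i, False)] \<in> carrier (free_group n)"
    using assms by (simp add: free_group_def)
  ultimately show ?thesis
    using F.inv_equality[OF _ gen_in_free_group[OF assms]] by simp
qed

lemma inv_inverse_letter:
  assumes "i \<in> {1..n}"
  shows "inv\<^bsub>free_group n\<^esub> [(i, False)] = gen i"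
  using group.inv_inv[OF group_free_group gen_in_free_group[OF assms]] inv_gen[OF assms] by simp

lemma palindromic_AutoGroup_carrier [simp]:
  "carrier (palindromic_AutoGroup n) = palindromic_auto n"
  by (simp add: palindromic_AutoGroup_def)

lemma palindromic_auto_hom:
  "\<phi> \<in> palindromic_auto n \<Longrightarrow> \<phi> \<in> hom (free_group n) (free_group n)"
  by (simp add: palindromic_auto_def auto_def)

lemma palindromic_auto_closed:
  "\<lbrakk>\<phi> \<in> palindromic_auto n; w \<in> carrier (free_group n)\<rbrakk> \<Longrightarrow> \<phi> w \<in> carrier (free_group n)"
  by (meson palindromic_auto_hom hom_in_carrier)

lemma palindromic_AutoGroup_mult_apply:
  assumes "\<phi> \<in> palindromic_auto n" "\<psi> \<in> palindromic_auto n" "w \<in> carrier (free_group n)"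
  shows "(\<phi> \<otimes>\<^bsub>palindromic_AutoGroup n\<^esub> \<psi>) w = \<phi> (\<psi> w)"
  using assms
  by (simp add: palindromic_AutoGroup_def AutoGroup_def BijGroup_def palindromic_auto_def auto_def
      compose_def)

lemma palindromic_AutoGroup_one_apply:
  "w \<in> carrier (free_group n) \<Longrightarrow> \<one>\<^bsub>palindromic_AutoGroup n\<^esub> w = w"
  by (simp add: palindromic_AutoGroup_def AutoGroup_def BijGroup_def)

text \<open>On the carrier this is uniqueness of homomorphisms out of a free group; off the carrier
  both maps are \<open>undefined\<close>, being extensional.\<close>

lemma palindromic_auto_eqI:
  assumes "\<phi> \<in> palindromic_auto n" "\<psi> \<in> palindromic_auto n"
    and "\<And>i. i \<in> {1..n} \<Longrightarrow> \<phi> (gen i) = \<psi> (gen i)"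
  shows "\<phi> = \<psi>"
proof (rule extensionalityI)
  show "\<phi> \<in> extensional (carrier (free_group n))" "\<psi> \<in> extensional (carrier (free_group n))"
    using assms(1,2) by (auto simp: palindromic_auto_def auto_def Bij_def)
  show "\<phi> w = \<psi> w" if "w \<in> carrier (free_group n)" for w
    using free_group_hom_unique[OF group_free_group _ _ _ that] palindromic_auto_hom assms by blast
qed

text \<open>The restriction is there because the elements of \<open>auto\<close> are extensional
  maps.\<close>

definition free_extension :: "nat \<Rightarrow> (nat \<Rightarrow> letter list) \<Rightarrow> letter list \<Rightarrow> letter list" where
  "free_extension n f = restrict (word_map (free_group n) f) (carrier (free_group n))"

lemma free_extension_gen:
  assumes "\<And>i. i \<in> {1..n} \<Longrightarrow> f i \<in> carrier (free_group n)" "i \<in> {1..n}"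
  shows "free_extension n f (gen i) = f i"
  using free_group_hom_exists(2)[OF group_free_group assms] gen_in_free_group[OF assms(2)]
  by (simp add: free_extension_def)

text \<open>Bijectivity is certified by a candidate inverse \<open>g\<close>: both composites are
  endomorphisms fixing every generator, hence the identity. All checks thus take place on
  generators.\<close>

lemma free_extension_palindromic_auto:
  assumes f: "\<And>i. i \<in> {1..n} \<Longrightarrow> f i \<in> carrier (free_group n)"
    and g: "\<And>i. i \<in> {1..n} \<Longrightarrow> g i \<in> carrier (free_group n)"
    and fg: "\<And>i. i \<in> {1..n} \<Longrightarrow> word_map (free_group n) f (g i) = gen i"
    and gf: "\<And>i. i \<in> {1..n} \<Longrightarrow> word_map (free_group n) g (f i) = gen i"
    and pal: "\<And>i. i \<in> {1..n} \<Longrightarrow> rev (f i) = f i"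
  shows "free_extension n f \<in> palindromic_auto n"
proof -
  let ?F = "free_group n" and ?f = "word_map (free_group n) f" and ?g = "word_map (free_group n) g"
  interpret F: group ?F by (rule group_free_group)
  have hf: "?f \<in> hom ?F ?F" and hg: "?g \<in> hom ?F ?F"
    using free_group_hom_exists(1)[OF group_free_group] f g by blast+
  have gens: "?f (gen i) = f i" "?g (gen i) = g i" if "i \<in> {1..n}" for i
    using free_group_hom_exists(2)[OF group_free_group] f g that by blast+
  have id: "(\<lambda>w. w) \<in> hom ?F ?F" by (auto simp: hom_def)
  have "compose (carrier ?F) ?f ?g \<in> hom ?F ?F" "compose (carrier ?F) ?g ?f \<in> hom ?F ?F"
    using F.hom_compose hf hg by blast+
  note comp = this
  have inv1: "?f (?g w) = w" if "w \<in> carrier ?F" for w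
    using free_group_hom_unique[OF group_free_group comp(1) id _ that] that fg gens gen_in_free_group
    by (simp add: compose_def)
  have inv2: "?g (?f w) = w" if "w \<in> carrier ?F" for w
    using free_group_hom_unique[OF group_free_group comp(2) id _ that] that gf gens gen_in_free_group
    by (simp add: compose_def)
  have "bij_betw ?f (carrier ?F) (carrier ?F)"
    by (rule bij_betw_byWitness[where f' = ?g]) (use inv1 inv2 hf hg in \<open>auto simp: hom_def\<close>)
  then have "free_extension n f \<in> Bij (carrier ?F)"
    by (simp add: Bij_def free_extension_def)
  moreover have "free_extension n f \<in> hom ?F ?F"
    using hf by (auto simp: hom_def free_extension_def)
  moreover have "palindromic (free_extension n f (gen i))" if "i \<in> {1..n}" for i
  proof -
    have "free_extension n f (gen i) = f i" using free_extension_gen f that by blast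
    then show ?thesis using f[OF that] pal[OF that] by (simp add: palindromic_def free_group_def)
  qed
  ultimately show ?thesis by (simp add: palindromic_auto_def auto_def)
qed

lemma word_map_Nil [simp]: "word_map H f [] = \<one>\<^bsub>H\<^esub>"
  and word_map_Cons [simp]: "word_map H f (x # w) = letter_map H f x \<otimes>\<^bsub>H\<^esub> word_map H f w"
  by (simp_all add: word_map_def)

section \<open>Palindromic transvections and inversions\<close>

definition transvection_images :: "nat \<Rightarrow> nat \<Rightarrow> bool \<Rightarrow> nat \<Rightarrow> letter list" where
  "transvection_images i j s k = (if k = i then [(j, s), (i, True), (j, s)] else gen k)"

definition palindromic_transvection :: "nat \<Rightarrow> nat \<Rightarrow> nat \<Rightarrow> letter list \<Rightarrow> letter list" where
  "palindromic_transvection n i j = free_extension n (transvection_images i j True)"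

text \<open>The flag \<open>k \<noteq> i\<close> is \<open>False\<close> exactly at
  \<open>k = i\<close>, so only that generator is inverted.\<close>

definition inversion :: "nat \<Rightarrow> nat \<Rightarrow> letter list \<Rightarrow> letter list" where
  "inversion n i = free_extension n (\<lambda>k. [(k, k \<noteq> i)])"

context
  fixes n i j :: nat
  assumes ij: "i \<in> {1..n}" "j \<in> {1..n}" "i \<noteq> j"
begin

lemma transvection_images_closed: "k \<in> {1..n} \<Longrightarrow> transvection_images i j s k \<in> carrier (free_group n)"
  using ij by (auto simp: transvection_images_def gen_in_free_group) (auto simp: free_group_def inv_letter_def)

text \<open>\<open>s\<close> is the sign of the two outer letters. Both maps fix a_j, so the outer
  letters of opposite sign cancel.\<close>

lemma transvection_images_inverse:
  assumes "k \<in> {1..n}"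
  shows "word_map (free_group n) (transvection_images i j s) (transvection_images i j (\<not> s) k) = gen k"
  using assms ij inv_gen[OF ij(2)]
  by (auto simp: transvection_images_def letter_map_def gen_def)
    (auto simp: free_group_def reduce_def cons_reduce_def inv_letter_def)

lemma palindromic_transvection_palindromic_auto:
  "palindromic_transvection n i j \<in> palindromic_auto n"
  unfolding palindromic_transvection_def
  by (rule free_extension_palindromic_auto[where g = "transvection_images i j False"])
    (use transvection_images_closed transvection_images_inverse[where s = True]
      transvection_images_inverse[where s = False] in \<open>simp_all add: transvection_images_def gen_def\<close>)

lemma palindromic_transvection_gen:
  "k \<in> {1..n} \<Longrightarrow> palindromic_transvection n i j (gen k)
    = (if k = i then [(j, True), (i, True), (j, True)] else gen k)"
  using free_extension_gen[of n "transvection_images i j True" k] transvection_images_closed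
  unfolding palindromic_transvection_def transvection_images_def by blast

end

lemma inversion_palindromic_auto: "inversion n i \<in> palindromic_auto n"
proof -
  have "word_map (free_group n) (\<lambda>k. [(k, k \<noteq> i)]) [(k, k \<noteq> i)] = gen k" if "k \<in> {1..n}" for k
    using inv_inverse_letter[OF that]
    by (auto simp: letter_map_def) (auto simp: free_group_def gen_def)
  then show ?thesis
    unfolding inversion_def
    by (intro free_extension_palindromic_auto[where g = "\<lambda>k. [(k, k \<noteq> i)]"])
      (auto simp: free_group_def)
qed

lemma inversion_gen: "k \<in> {1..n} \<Longrightarrow> inversion n i (gen k) = [(k, k \<noteq> i)]"
  unfolding inversion_def by (rule free_extension_gen) (auto simp: free_group_def)

lemma hom_free_group_letter:
  assumes "\<phi> \<in> hom (free_group n) (free_group n)" "k \<in> {1..n}"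
  shows "\<phi> [(k, False)] = inv\<^bsub>free_group n\<^esub> (\<phi> (gen k))"
  using group_hom.hom_inv[of "free_group n" "free_group n" \<phi> "gen k"] assms
    inv_gen[OF assms(2)] gen_in_free_group[OF assms(2)] group_free_group
  by (simp add: group_hom_def group_hom_axioms_def)

text \<open>Lets an endomorphism be evaluated letter by letter: as \<open>x # w\<close> is reduced,
  it is the product of \<open>[x]\<close> and \<open>w\<close>.\<close>

lemma hom_free_group_Cons:
  assumes "\<phi> \<in> hom (free_group n) (free_group n)" "x # w \<in> carrier (free_group n)"
  shows "\<phi> (x # w) = reduce (\<phi> [x] @ \<phi> w)"
proof -
  have "x # w = [x] \<otimes>\<^bsub>free_group n\<^esub> w"
    using assms(2) by (simp add: free_group_def)
  moreover have "\<phi> ([x] \<otimes>\<^bsub>free_group n\<^esub> w) = \<phi> [x] \<otimes>\<^bsub>free_group n\<^esub> \<phi> w"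
    using assms by (intro hom_mult[of \<phi> "free_group n"]) (auto simp: free_group_def)
  ultimately show ?thesis by (simp add: free_group_def)
qed

text \<open>The two maps affect different generators: the inversion fixes every letter of a_j a_i
  a_j, and the transvection fixes a_k, hence also its inverse.\<close>

lemma inversion_commutes_transvection:
  assumes "i \<in> {1..n}" "j \<in> {1..n}" "i \<noteq> j" "k \<in> {1..n}" "k \<noteq> i" "k \<noteq> j"
  defines "G \<equiv> palindromic_AutoGroup n"
  shows "inversion n k \<otimes>\<^bsub>G\<^esub> palindromic_transvection n i j
    = palindromic_transvection n i j \<otimes>\<^bsub>G\<^esub> inversion n k"
proof -
  interpret group G unfolding G_def by (rule group_palindromic_AutoGroup)
  let ?t = "palindromic_transvection n i j" and ?s = "inversion n k"
  note t = palindromic_transvection_palindromic_auto[OF assms(1-3)]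
  note s = inversion_palindromic_auto[of n k]
  show ?thesis
  proof (rule palindromic_auto_eqI)
    show "?s \<otimes>\<^bsub>G\<^esub> ?t \<in> palindromic_auto n" "?t \<otimes>\<^bsub>G\<^esub> ?s \<in> palindromic_auto n"
      using m_closed[of ?s ?t] m_closed[of ?t ?s] s t by (simp_all add: G_def)
    fix l assume l: "l \<in> {1..n}"
    note gen = gen_in_free_group[OF l]
    have "?s (?t (gen l)) = ?t (?s (gen l))"
    proof (cases "l = i")
      case True
      have ij: "?s [(i, True)] = [(i, True)]" "?s [(j, True)] = [(j, True)]"
        using inversion_gen[of i n k] inversion_gen[of j n k] assms by (auto simp: gen_def)
      have w: "[(j, True), (i, True), (j, True)] \<in> carrier (free_group n)"
        using assms by (auto simp: free_group_def inv_letter_def)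
      then have w': "[(i, True), (j, True)] \<in> carrier (free_group n)"
        by (auto simp: free_group_def)
      have "?s [(j, True), (i, True), (j, True)] = [(j, True), (i, True), (j, True)]"
        using hom_free_group_Cons[OF palindromic_auto_hom[OF s] w]
          hom_free_group_Cons[OF palindromic_auto_hom[OF s] w'] ij assms
        by (simp add: inv_letter_def)
      moreover have "?t (gen i) = [(j, True), (i, True), (j, True)]"
        using palindromic_transvection_gen[OF assms(1-3,1)] by simp
      moreover have "?s (gen i) = gen i" using ij by (simp add: gen_def)
      ultimately show ?thesis using True by simp
    next
      case False
      have tl: "?t (gen l) = gen l"
        using palindromic_transvection_gen[OF assms(1-3) l] False by simp
      show ?thesis
      proof (cases "l = k")
        case True
        have "?t [(l, False)] = [(l, False)]"
          using hom_free_group_letter[OF palindromic_auto_hom[OF t] l] tl inv_gen[OF l] by simp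
        then show ?thesis using tl True inversion_gen[OF l] by simp
      next
        case False
        then show ?thesis using tl inversion_gen[OF l] by (simp add: gen_def)
      qed
    qed
    then show "(?s \<otimes>\<^bsub>G\<^esub> ?t) (gen l) = (?t \<otimes>\<^bsub>G\<^esub> ?s) (gen l)"
      unfolding G_def using palindromic_AutoGroup_mult_apply s t gen by simp
  qed
qed

section \<open>The action on the abelianization\<close>

text \<open>The \<open>i\<close>-th coordinate of the abelianization map to Z^n.\<close>

definition exponent_sum :: "nat \<Rightarrow> letter list \<Rightarrow> int" where
  "exponent_sum i w = (\<Sum>x\<leftarrow>w. if fst x = i then if snd x then 1 else -1 else 0)"

text \<open>The matrix induced on Z^n. The images of the generators are its columns, so composition
  becomes the matrix product in the same order.\<close>

definition ab_matrix :: "(letter list \<Rightarrow> letter list) \<Rightarrow> nat \<Rightarrow> nat \<Rightarrow> int" where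
  "ab_matrix \<phi> i j = exponent_sum i (\<phi> (gen j))"

lemma exponent_sum_simps [simp]:
  "exponent_sum i [] = 0"
  "exponent_sum i (x # w)
    = (if fst x = i then if snd x then 1 else -1 else 0) + exponent_sum i w"
  "exponent_sum i (u @ v) = exponent_sum i u + exponent_sum i v"
  by (simp_all add: exponent_sum_def)

lemma exponent_sum_reduce [simp]: "exponent_sum i (reduce w) = exponent_sum i w"
proof (induction w)
  case (Cons x w)
  have "exponent_sum i (cons_reduce x v) = exponent_sum i (x # v)" for v
    by (cases v) (auto simp: cons_reduce_def inv_letter_def)
  with Cons show ?case by (simp add: reduce_def)
qed simp

lemma exponent_sum_hom: "exponent_sum i \<in> hom (free_group n) integer_group"
  by (rule homI) (simp_all add: free_group_def)

text \<open>Both sides are homomorphisms in \<open>w\<close> to the integers, and they agree on the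
  generators.\<close>

lemma exponent_sum_image:
  assumes "\<phi> \<in> palindromic_auto n" "w \<in> carrier (free_group n)"
  shows "exponent_sum i (\<phi> w) = (\<Sum>k\<in>{1..n}. ab_matrix \<phi> i k * exponent_sum k w)"
proof -
  let ?f = "compose (carrier (free_group n)) (exponent_sum i) \<phi>"
  let ?g = "\<lambda>w. \<Sum>k\<in>{1..n}. ab_matrix \<phi> i k * exponent_sum k w"
  have f: "?f \<in> hom (free_group n) integer_group"
    using group.hom_compose[OF group_free_group palindromic_auto_hom[OF assms(1)] exponent_sum_hom] .
  have g: "?g \<in> hom (free_group n) integer_group"
    by (rule homI) (simp_all add: free_group_def sum.distrib distrib_left)
  have gens: "?f (gen j) = ?g (gen j)" if j: "j \<in> {1..n}" for j
  proof -
    have "?g (gen j) = (\<Sum>k\<in>{1..n}. if k = j then ab_matrix \<phi> i j else 0)"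
      by (rule sum.cong) (auto simp: gen_def)
    also have "\<dots> = ab_matrix \<phi> i j" using j by simp
    finally show ?thesis using gen_in_free_group[OF j] by (simp add: compose_def ab_matrix_def)
  qed
  have "?f w = ?g w"
    by (rule free_group_hom_unique[OF group_integer_group f g gens assms(2)])
  then show ?thesis using assms(2) by (simp add: compose_def)
qed

lemma ab_matrix_mult:
  assumes "\<phi> \<in> palindromic_auto n" "\<psi> \<in> palindromic_auto n" "j \<in> {1..n}"
  shows "ab_matrix (\<phi> \<otimes>\<^bsub>palindromic_AutoGroup n\<^esub> \<psi>) i j
    = (\<Sum>k\<in>{1..n}. ab_matrix \<phi> i k * ab_matrix \<psi> k j)"
  using exponent_sum_image[OF assms(1) palindromic_auto_closed[OF assms(2) gen_in_free_group[OF assms(3)]]]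
    palindromic_AutoGroup_mult_apply[OF assms(1,2) gen_in_free_group[OF assms(3)]]
  by (simp add: ab_matrix_def)

lemma ab_matrix_one:
  "j \<in> {1..n} \<Longrightarrow> ab_matrix \<one>\<^bsub>palindromic_AutoGroup n\<^esub> i j = (if i = j then 1 else 0)"
  using palindromic_AutoGroup_one_apply[OF gen_in_free_group] by (simp add: ab_matrix_def) (simp add: gen_def)

lemma ab_matrix_transvection:
  assumes "i \<in> {1..n}" "j \<in> {1..n}" "i \<noteq> j" "l \<in> {1..n}"
  shows "ab_matrix (palindromic_transvection n i j) k l
    = (if k = l then 1 else if k = j \<and> l = i then 2 else 0)"
  using palindromic_transvection_gen[OF assms] assms(3) by (auto simp: ab_matrix_def gen_def)

lemma ab_matrix_inversion:
  assumes "l \<in> {1..n}"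
  shows "ab_matrix (inversion n i) k l = (if k = l then if k = i then -1 else 1 else 0)"
  using inversion_gen[OF assms] by (auto simp: ab_matrix_def)

section \<open>The trace on the abelianization as a conjugation invariant\<close>

definition ab_trace :: "nat \<Rightarrow> (letter list \<Rightarrow> letter list) \<Rightarrow> int" where
  "ab_trace n \<phi> = (\<Sum>i\<in>{1..n}. ab_matrix \<phi> i i)"

lemma ab_trace_commute:
  assumes "\<phi> \<in> palindromic_auto n" "\<psi> \<in> palindromic_auto n"
  shows "ab_trace n (\<phi> \<otimes>\<^bsub>palindromic_AutoGroup n\<^esub> \<psi>) = ab_trace n (\<psi> \<otimes>\<^bsub>palindromic_AutoGroup n\<^esub> \<phi>)"
proof -
  have "ab_trace n (\<phi> \<otimes>\<^bsub>palindromic_AutoGroup n\<^esub> \<psi>) = (\<Sum>i\<in>{1..n}. \<Sum>k\<in>{1..n}. ab_matrix \<phi> i k * ab_matrix \<psi> k i)"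
    by (simp add: ab_trace_def ab_matrix_mult assms)
  also have "\<dots> = (\<Sum>k\<in>{1..n}. \<Sum>i\<in>{1..n}. ab_matrix \<psi> k i * ab_matrix \<phi> i k)"
    by (subst sum.swap) (simp add: mult.commute)
  also have "\<dots> = ab_trace n (\<psi> \<otimes>\<^bsub>palindromic_AutoGroup n\<^esub> \<phi>)"
    by (simp add: ab_trace_def ab_matrix_mult assms)
  finally show ?thesis .
qed

lemma ab_trace_conjugate:
  assumes "\<phi> \<in> palindromic_auto n" "g \<in> palindromic_auto n"
  defines "G \<equiv> palindromic_AutoGroup n"
  shows "ab_trace n (g \<otimes>\<^bsub>G\<^esub> \<phi> \<otimes>\<^bsub>G\<^esub> inv\<^bsub>G\<^esub> g) = ab_trace n \<phi>"
proof -
  interpret group G unfolding G_def by (rule group_palindromic_AutoGroup)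
  have G: "carrier G = palindromic_auto n" by (simp add: G_def)
  have "ab_trace n (g \<otimes>\<^bsub>G\<^esub> \<phi> \<otimes>\<^bsub>G\<^esub> inv\<^bsub>G\<^esub> g) = ab_trace n (inv\<^bsub>G\<^esub> g \<otimes>\<^bsub>G\<^esub> (g \<otimes>\<^bsub>G\<^esub> \<phi>))"
    unfolding G_def by (rule ab_trace_commute) (use assms m_closed inv_closed in \<open>auto simp: G_def\<close>)
  also have "inv\<^bsub>G\<^esub> g \<otimes>\<^bsub>G\<^esub> (g \<otimes>\<^bsub>G\<^esub> \<phi>) = \<phi>"
    using assms(1,2) unfolding G[symmetric] by (simp add: m_assoc[symmetric])
  finally show ?thesis .
qed

section \<open>Hyperbolic elements of the block \<open>a\<^sub>1, a\<^sub>2\<close>\<close>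

text \<open>\<open>x\<close> is central in its own centralizer, so its conjugate by \<open>g\<close>
  commutes with the conjugated centralizer, which is all of \<open>centralizer G y\<close> for a
  suitable \<open>g\<close>.\<close>

lemma (in group) z_equivalent_conjugate_commutes:
  assumes "(x, y) \<in> z_equivalence G"
  obtains g where "g \<in> carrier G"
    "\<And>h. h \<in> centralizer G y \<Longrightarrow> h \<otimes> (g \<otimes> x \<otimes> inv g) = (g \<otimes> x \<otimes> inv g) \<otimes> h"
proof -
  obtain g where g: "g \<in> carrier G" "x \<in> carrier G"
    "centralizer G y = g <# centralizer G x #> inv g"
    using assms by (auto simp: z_equivalence_def conjugate_in_def)
  have "h \<otimes> (g \<otimes> x \<otimes> inv g) = (g \<otimes> x \<otimes> inv g) \<otimes> h" if "h \<in> centralizer G y" for h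
  proof -
    obtain k where k: "k \<in> carrier G" "k \<otimes> x = x \<otimes> k" "h = g \<otimes> k \<otimes> inv g"
      using \<open>h \<in> centralizer G y\<close> unfolding g(3)
      by (auto simp: centralizer_def l_coset_def r_coset_def)
    \<comment> \<open>Conjugation by \<open>g\<close> is multiplicative, so it carries the relation
      between \<open>k\<close> and \<open>x\<close> over to their conjugates.\<close>
    have "(g \<otimes> u \<otimes> inv g) \<otimes> (g \<otimes> v \<otimes> inv g) = g \<otimes> (u \<otimes> v) \<otimes> inv g"
      if "u \<in> carrier G" "v \<in> carrier G" for u v
      using that g(1) by (simp add: m_assoc inv_solve_left' flip: m_assoc[of "inv g" g])
    then show ?thesis using k g(2) by simp
  qed
  with g(1) show ?thesis using that by blast
qed

section \<open>Matrices of products and of the elements alpha^p beta\<close>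

context
  fixes n :: nat
  assumes n: "2 \<le> n"
begin

interpretation G: group "palindromic_AutoGroup n"
  by (rule group_palindromic_AutoGroup)

abbreviation auto_mult (infixl "\<odot>" 70) where
  "\<phi> \<odot> \<psi> \<equiv> \<phi> \<otimes>\<^bsub>palindromic_AutoGroup n\<^esub> \<psi>"

lemma times_closed: "\<lbrakk>\<phi> \<in> palindromic_auto n; \<psi> \<in> palindromic_auto n\<rbrakk> \<Longrightarrow> \<phi> \<odot> \<psi> \<in> palindromic_auto n"
  using G.m_closed[of \<phi> \<psi>] by simp

lemma sum_split_two: "(\<Sum>k\<in>{1..n}. f k) = f 1 + f 2 + (\<Sum>k\<in>{3..n}. f k)" for f :: "nat \<Rightarrow> int"
proof -
  have "{1..n} = insert 1 (insert 2 {3..n})" using n by auto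
  then show ?thesis by (simp add: add.assoc)
qed

text \<open>Right multiplication by an elementary matrix, with its entry 2 in row \<open>j\<close>
  and column \<open>i\<close>, is a column operation.\<close>

lemma ab_matrix_times_transvection:
  assumes "\<phi> \<in> palindromic_auto n" "i \<in> {1..n}" "j \<in> {1..n}" "i \<noteq> j" "l \<in> {1..n}"
  shows "ab_matrix (\<phi> \<odot> palindromic_transvection n i j) k l
    = ab_matrix \<phi> k l + (if l = i then 2 * ab_matrix \<phi> k j else 0)"
proof -
  have "ab_matrix (\<phi> \<odot> palindromic_transvection n i j) k l
      = (\<Sum>m\<in>{1..n}. (if m = l then ab_matrix \<phi> k l else 0)
          + (if m = j then if l = i then 2 * ab_matrix \<phi> k j else 0 else 0))"
    unfolding ab_matrix_mult[OF assms(1) palindromic_transvection_palindromic_auto[OF assms(2-4)] assms(5)]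
    using assms by (intro sum.cong) (auto simp: ab_matrix_transvection)
  also have "\<dots> = ab_matrix \<phi> k l + (if l = i then 2 * ab_matrix \<phi> k j else 0)"
    unfolding sum.distrib using assms(3,5) by (simp only: sum.delta finite_atLeastAtMost if_True)
  finally show ?thesis .
qed

text \<open>An inversion is a diagonal sign matrix: on the right it changes the sign of a column, on
  the left that of a row. Comparing the two later forces entries to vanish.\<close>

lemma ab_matrix_times_inversion:
  assumes "\<phi> \<in> palindromic_auto n" "l \<in> {1..n}"
  shows "ab_matrix (\<phi> \<odot> inversion n i) k l = (if l = i then - ab_matrix \<phi> k l else ab_matrix \<phi> k l)"
proof -
  have "ab_matrix (\<phi> \<odot> inversion n i) k l
      = (\<Sum>m\<in>{1..n}. if m = l then if l = i then - ab_matrix \<phi> k l else ab_matrix \<phi> k l else 0)"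
    unfolding ab_matrix_mult[OF assms(1) inversion_palindromic_auto assms(2)]
    using assms(2) by (intro sum.cong) (auto simp: ab_matrix_inversion)
  then show ?thesis using assms(2) by (simp only: sum.delta finite_atLeastAtMost if_True)
qed

lemma ab_matrix_inversion_times:
  assumes "\<phi> \<in> palindromic_auto n" "k \<in> {1..n}" "l \<in> {1..n}"
  shows "ab_matrix (inversion n i \<odot> \<phi>) k l = (if k = i then - ab_matrix \<phi> k l else ab_matrix \<phi> k l)"
proof -
  have "ab_matrix (inversion n i \<odot> \<phi>) k l
      = (\<Sum>m\<in>{1..n}. if m = k then if k = i then - ab_matrix \<phi> k l else ab_matrix \<phi> k l else 0)"
    unfolding ab_matrix_mult[OF inversion_palindromic_auto assms(1,3)]
    by (intro sum.cong) (auto simp: ab_matrix_inversion)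
  then show ?thesis using assms(2) by (simp only: sum.delta finite_atLeastAtMost if_True)
qed

text \<open>The name refers to the 2x2 block on a_1, a_2, which has determinant 1 and trace 4p + 2,
  exceeding 2 for \<open>p > 0\<close>.\<close>

definition hyperbolic :: "nat \<Rightarrow> letter list \<Rightarrow> letter list" where
  "hyperbolic p = palindromic_transvection n 1 2 [^]\<^bsub>palindromic_AutoGroup n\<^esub> p
    \<odot> palindromic_transvection n 2 1"

lemma transvections_12:
  "palindromic_transvection n 1 2 \<in> palindromic_auto n"
  "palindromic_transvection n 2 1 \<in> palindromic_auto n"
  using n by (intro palindromic_transvection_palindromic_auto; simp)+

lemma transvection_pow_closed:
  "palindromic_transvection n 1 2 [^]\<^bsub>palindromic_AutoGroup n\<^esub> (p :: nat) \<in> palindromic_auto n"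
  using G.nat_pow_closed[of "palindromic_transvection n 1 2" p] transvections_12(1) by simp

lemma hyperbolic_palindromic_auto: "hyperbolic p \<in> palindromic_auto n"
  unfolding hyperbolic_def by (intro times_closed transvection_pow_closed transvections_12)

lemma ab_matrix_transvection_pow:
  assumes "l \<in> {1..n}"
  shows "ab_matrix (palindromic_transvection n 1 2 [^]\<^bsub>palindromic_AutoGroup n\<^esub> (p :: nat)) k l
    = (if k = l then 1 else if k = 2 \<and> l = 1 then 2 * int p else 0)"
  using assms
proof (induction p arbitrary: l)
  case 0
  then show ?case using ab_matrix_one[of l n k] by simp
next
  case (Suc p)
  \<comment> \<open>The power grows on the right, so the step adds twice column 2 to column 1. It
    uses the induction hypothesis for column 2 as well, hence \<open>arbitrary: l\<close>.\<close>
  have "(2::nat) \<in> {1..n}" "(1::nat) \<in> {1..n}" using n by auto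
  then show ?case
    using Suc.IH[OF Suc.prems] Suc.IH[of 2]
      ab_matrix_times_transvection[OF transvection_pow_closed, of 1 2 l p k] Suc.prems
    by (auto simp: algebra_simps)
qed

lemma ab_matrix_hyperbolic:
  assumes "l \<in> {1..n}"
  shows "ab_matrix (hyperbolic p) k l
    = (if k = 1 \<and> l = 2 then 2 else if k = 2 \<and> l = 1 then 2 * int p
       else if k = 2 \<and> l = 2 then 4 * int p + 1 else if k = l then 1 else 0)"
proof -
  have "(2::nat) \<in> {1..n}" "(1::nat) \<in> {1..n}" using n by auto
  then show ?thesis
    unfolding hyperbolic_def
    using ab_matrix_times_transvection[OF transvection_pow_closed, of 2 1 l p k] assms
      ab_matrix_transvection_pow[OF assms, of p k] ab_matrix_transvection_pow[of 1 p k]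
    by (auto split: if_splits)
qed

section \<open>The centralizer of the inversions of a_3, ..., a_n\<close>

definition commutes_with_inversions :: "(letter list \<Rightarrow> letter list) set" where
  "commutes_with_inversions = {\<phi> \<in> palindromic_auto n. \<forall>i\<in>{3..n}. inversion n i \<odot> \<phi> = \<phi> \<odot> inversion n i}"

lemma commutes_with_inversions_times:
  assumes "\<phi> \<in> commutes_with_inversions" "\<psi> \<in> commutes_with_inversions"
  shows "\<phi> \<odot> \<psi> \<in> commutes_with_inversions"
proof -
  have "inversion n i \<odot> (\<phi> \<odot> \<psi>) = (\<phi> \<odot> \<psi>) \<odot> inversion n i" if "i \<in> {3..n}" for i
  proof -
    have c: "\<phi> \<in> carrier (palindromic_AutoGroup n)" "\<psi> \<in> carrier (palindromic_AutoGroup n)"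
      "inversion n i \<in> carrier (palindromic_AutoGroup n)"
      using assms inversion_palindromic_auto by (auto simp: commutes_with_inversions_def)
    have e: "inversion n i \<odot> \<phi> = \<phi> \<odot> inversion n i" "inversion n i \<odot> \<psi> = \<psi> \<odot> inversion n i"
      using assms that by (auto simp: commutes_with_inversions_def)
    show ?thesis by (metis c e G.m_assoc)
  qed
  then show ?thesis using assms times_closed by (auto simp: commutes_with_inversions_def)
qed

text \<open>If exactly one of \<open>k\<close> and \<open>l\<close> equals \<open>i\<close>, the
  \<open>(k, l)\<close> entries of the two products with \<open>inversion n i\<close> are m and -m.
  So the matrix is a 2x2 block followed by a diagonal part.\<close>

lemma commutes_with_inversions_offdiag:
  assumes "\<phi> \<in> commutes_with_inversions" "k \<in> {1..n}" "l \<in> {1..n}" "k \<noteq> l" "3 \<le> k \<or> 3 \<le> l"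
  shows "ab_matrix \<phi> k l = 0"
proof -
  have pal: "\<phi> \<in> palindromic_auto n" using assms(1) by (simp add: commutes_with_inversions_def)
  obtain i where i: "i \<in> {3..n}" "i = k \<or> i = l" using assms by auto
  then have "inversion n i \<odot> \<phi> = \<phi> \<odot> inversion n i"
    using assms(1) by (simp add: commutes_with_inversions_def)
  then show ?thesis
    using i(2) assms(4) ab_matrix_times_inversion[OF pal assms(3), of i k]
      ab_matrix_inversion_times[OF pal assms(2,3), of i] by (auto split: if_splits)
qed

lemma ab_matrix_times_block:
  assumes "\<phi> \<in> commutes_with_inversions" "\<psi> \<in> palindromic_auto n"
    and "i \<in> {1, 2}" "j \<in> {1..n}"
  shows "ab_matrix (\<phi> \<odot> \<psi>) i j = ab_matrix \<phi> i 1 * ab_matrix \<psi> 1 j + ab_matrix \<phi> i 2 * ab_matrix \<psi> 2 j"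
proof -
  have "\<phi> \<in> palindromic_auto n" using assms(1) by (simp add: commutes_with_inversions_def)
  moreover have "ab_matrix \<phi> i k = 0" if "k \<in> {3..n}" for k
    using that assms(3) n by (intro commutes_with_inversions_offdiag[OF assms(1)]) auto
  ultimately show ?thesis
    using ab_matrix_mult[OF _ assms(2,4), of \<phi> i] unfolding sum_split_two by simp
qed

text \<open>Row \<open>i\<close> of the left factor vanishes off the diagonal, so only that factor
  has to have block shape; the right one may be an inverse.\<close>

lemma ab_matrix_times_diag:
  assumes "\<phi> \<in> commutes_with_inversions" "\<psi> \<in> palindromic_auto n" "i \<in> {3..n}"
  shows "ab_matrix (\<phi> \<odot> \<psi>) i i = ab_matrix \<phi> i i * ab_matrix \<psi> i i"
proof -
  have i: "i \<in> {1..n}" using assms(3) by auto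
  have pal: "\<phi> \<in> palindromic_auto n" using assms(1) by (simp add: commutes_with_inversions_def)
  have "ab_matrix (\<phi> \<odot> \<psi>) i i
      = (\<Sum>k\<in>{1..n}. if k = i then ab_matrix \<phi> i i * ab_matrix \<psi> i i else 0)"
    unfolding ab_matrix_mult[OF pal assms(2) i]
  proof (rule sum.cong)
    fix k assume "k \<in> {1..n}"
    then show "ab_matrix \<phi> i k * ab_matrix \<psi> k i = (if k = i then ab_matrix \<phi> i i * ab_matrix \<psi> i i else 0)"
      using commutes_with_inversions_offdiag[OF assms(1) i, of k] assms(3) by auto
  qed simp
  then show ?thesis using i by (simp only: sum.delta finite_atLeastAtMost if_True)
qed

text \<open>The diagonal entry times that of the inverse is 1, so it is a unit of the integers.
  Squaring removes its sign.\<close>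

lemma commutes_with_inversions_diag_square:
  assumes "\<phi> \<in> commutes_with_inversions" "i \<in> {3..n}"
  shows "ab_matrix (\<phi> \<odot> \<phi>) i i = 1"
proof -
  let ?\<psi> = "inv\<^bsub>palindromic_AutoGroup n\<^esub> \<phi>"
  have pal: "\<phi> \<in> palindromic_auto n" using assms(1) by (simp add: commutes_with_inversions_def)
  then have "?\<psi> \<in> palindromic_auto n" using G.inv_closed[of \<phi>] by simp
  moreover have "\<phi> \<odot> ?\<psi> = \<one>\<^bsub>palindromic_AutoGroup n\<^esub>" using pal by simp
  ultimately have "ab_matrix \<phi> i i * ab_matrix ?\<psi> i i = 1"
    using ab_matrix_times_diag[OF assms(1) _ assms(2), of ?\<psi>] ab_matrix_one[of i n i] assms(2) by simp
  then have "ab_matrix \<phi> i i = 1 \<or> ab_matrix \<phi> i i = -1" by (simp add: zmult_eq_1_iff) blast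
  then show ?thesis using ab_matrix_times_diag[OF assms(1) pal assms(2)] by auto
qed

section \<open>Traces and discriminants of the 2x2 block, and their arithmetic\<close>

lemma ab_trace_block:
  assumes "\<And>i. i \<in> {3..n} \<Longrightarrow> ab_matrix \<phi> i i = 1"
  shows "ab_trace n \<phi> = ab_matrix \<phi> 1 1 + ab_matrix \<phi> 2 2 + (\<Sum>i\<in>{3..n}. 1)"
  unfolding ab_trace_def sum_split_two using assms by simp

text \<open>The discriminant of the upper left block \<open>M\<close> equals \<open>2 tr (M\<^sup>2) - (tr M)\<^sup>2\<close>.\<close>

lemma discriminant_of_traces:
  assumes "\<phi> \<in> commutes_with_inversions" "\<And>i. i \<in> {3..n} \<Longrightarrow> ab_matrix \<phi> i i = 1"
  defines "d \<equiv> (\<Sum>i\<in>{3..n}. 1)"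
  shows "(ab_matrix \<phi> 1 1 - ab_matrix \<phi> 2 2)\<^sup>2 + 4 * ab_matrix \<phi> 1 2 * ab_matrix \<phi> 2 1
    = 2 * (ab_trace n (\<phi> \<odot> \<phi>) - d) - (ab_trace n \<phi> - d)\<^sup>2"
proof -
  have pal: "\<phi> \<in> palindromic_auto n" using assms(1) by (simp add: commutes_with_inversions_def)
  have 12: "(1::nat) \<in> {1..n}" "(2::nat) \<in> {1..n}" using n by auto
  \<comment> \<open>The diagonal entries beyond the block are 1 for the square too, so both traces
    are reduced by the same \<open>d\<close>.\<close>
  have "ab_trace n (\<phi> \<odot> \<phi>) - d = ab_matrix (\<phi> \<odot> \<phi>) 1 1 + ab_matrix (\<phi> \<odot> \<phi>) 2 2"
    unfolding d_def by (subst ab_trace_block) (use ab_matrix_times_diag[OF assms(1) pal] assms(2) in auto)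
  moreover have "ab_trace n \<phi> - d = ab_matrix \<phi> 1 1 + ab_matrix \<phi> 2 2"
    unfolding d_def by (subst ab_trace_block) (use assms(2) in auto)
  ultimately show ?thesis
    using ab_matrix_times_block[OF assms(1) pal _ 12(1), of 1] ab_matrix_times_block[OF assms(1) pal _ 12(2), of 2]
    by (simp add: power2_eq_square algebra_simps)
qed

lemma hyperbolic_commutes_with_inversions: "hyperbolic p \<in> commutes_with_inversions"
proof -
  have t: "palindromic_transvection n 1 2 \<in> commutes_with_inversions"
    "palindromic_transvection n 2 1 \<in> commutes_with_inversions"
    using n inversion_commutes_transvection[of 1 n 2] inversion_commutes_transvection[of 2 n 1]
      transvections_12 by (auto simp: commutes_with_inversions_def)
  have "palindromic_transvection n 1 2 [^]\<^bsub>palindromic_AutoGroup n\<^esub> p \<in> commutes_with_inversions"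
  proof (induction p)
    case 0
    show ?case using G.one_closed inversion_palindromic_auto[of n]
      by (auto simp: commutes_with_inversions_def)
  next
    case (Suc p)
    then show ?case using t by (simp add: commutes_with_inversions_times)
  qed
  then show ?thesis unfolding hyperbolic_def using t by (intro commutes_with_inversions_times)
qed

text \<open>The block of \<open>hyperbolic p\<close> has trace 4p + 2 and discriminant 16p(p + 1).
  Squaring multiplies the discriminant by the square of the trace, as (u^2 - v^2)^2 = (u - v)^2 (u +
  v)^2 for eigenvalues u, v.\<close>

lemma hyperbolic_discriminant:
  fixes p :: nat
  defines "x \<equiv> hyperbolic p \<odot> hyperbolic p"
  shows "(ab_matrix x 1 1 - ab_matrix x 2 2)\<^sup>2 + 4 * ab_matrix x 1 2 * ab_matrix x 2 1
    = 16 * int p * (int p + 1) * (4 * int p + 2)\<^sup>2"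
proof -
  have 12: "(1::nat) \<in> {1..n}" "(2::nat) \<in> {1..n}" using n by auto
  note block = ab_matrix_times_block[OF hyperbolic_commutes_with_inversions hyperbolic_palindromic_auto, of _ _ p p]
  have "ab_matrix x 1 1 = 1 + 4 * int p" "ab_matrix x 1 2 = 2 + 2 * (4 * int p + 1)"
    "ab_matrix x 2 1 = 2 * int p + (4 * int p + 1) * (2 * int p)"
    "ab_matrix x 2 2 = 4 * int p + (4 * int p + 1)\<^sup>2"
    unfolding x_def using 12 by (simp_all add: block ab_matrix_hyperbolic power2_eq_square)
  then show ?thesis by (simp add: power2_eq_square algebra_simps)
qed

text \<open>A 2x2 matrix commuting with the non-scalar block B of \<open>hyperbolic p\<close> is s +
  tB for scalars s, t. The upper right entry 2 of B makes t half of
  \<open>ab_matrix \<phi> 1 2\<close>, and the discriminant is t^2 times 16p(p + 1).\<close>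

lemma discriminant_of_hyperbolic_centralizer:
  assumes "\<phi> \<in> commutes_with_inversions" "\<phi> \<odot> hyperbolic p = hyperbolic p \<odot> \<phi>"
  shows "(ab_matrix \<phi> 1 1 - ab_matrix \<phi> 2 2)\<^sup>2 + 4 * ab_matrix \<phi> 1 2 * ab_matrix \<phi> 2 1
    = 4 * int p * (int p + 1) * (ab_matrix \<phi> 1 2)\<^sup>2"
proof -
  have 12: "(1::nat) \<in> {1..n}" "(2::nat) \<in> {1..n}" using n by auto
  have pal: "\<phi> \<in> palindromic_auto n" using assms(1) by (simp add: commutes_with_inversions_def)
  note block = ab_matrix_times_block[OF hyperbolic_commutes_with_inversions pal]
    ab_matrix_times_block[OF assms(1) hyperbolic_palindromic_auto]
  \<comment> \<open>The first row of the commutation relation already yields both linear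
    equations.\<close>
  have "ab_matrix (\<phi> \<odot> hyperbolic p) 1 j = ab_matrix (hyperbolic p \<odot> \<phi>) 1 j" for j
    using assms(2) by simp
  from this[of 1] this[of 2]
  have "ab_matrix \<phi> 2 1 = int p * ab_matrix \<phi> 1 2"
    "ab_matrix \<phi> 2 2 = ab_matrix \<phi> 1 1 + 2 * int p * ab_matrix \<phi> 1 2"
    using 12 by (simp_all add: block ab_matrix_hyperbolic algebra_simps)
  then show ?thesis by (simp add: power2_eq_square algebra_simps)
qed

lemma conjugate_square:
  assumes "\<phi> \<in> palindromic_auto n" "g \<in> palindromic_auto n"
  defines "b \<equiv> \<lambda>\<phi>. g \<odot> \<phi> \<odot> inv\<^bsub>palindromic_AutoGroup n\<^esub> g"
  shows "b \<phi> \<odot> b \<phi> = b (\<phi> \<odot> \<phi>)"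
proof -
  have c: "\<phi> \<in> carrier (palindromic_AutoGroup n)" "g \<in> carrier (palindromic_AutoGroup n)"
    using assms by auto
  show ?thesis
    unfolding b_def using c unfolding palindromic_AutoGroup_carrier[symmetric]
    by (simp del: palindromic_AutoGroup_carrier add: G.m_assoc flip: G.m_assoc[of "inv\<^bsub>palindromic_AutoGroup n\<^esub> g" g])
qed

end

text \<open>As \<open>q\<close> exceeds \<open>p + 1\<close>, it divides the left side to an even
  power unless that side is 0, whereas it divides the positive right side exactly once.\<close>

lemma primes_discriminants_independent:
  fixes p q :: nat and c :: int
  assumes "prime p" "prime q" "2 < p" "p < q"
  shows "4 * int p * (int p + 1) * c\<^sup>2 \<noteq> 16 * int q * (int q + 1) * (4 * int q + 2)\<^sup>2"
proof
  assume eq: "4 * int p * (int p + 1) * c\<^sup>2 = 16 * int q * (int q + 1) * (4 * int q + 2)\<^sup>2"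
  have q: "prime (int q)" using assms(2) by simp
  \<comment> \<open>Odd primes are never consecutive integers, which rules out
    \<open>q = p + 1\<close>.\<close>
  have "odd p" "odd q" using assms prime_odd_nat by auto
  then have "p + 1 < q" using assms(4) by (cases "q = p + 1") auto
  then have ndvd: "\<not> int q dvd int p" "\<not> int q dvd int p + 1" 
    using assms zdvd_not_zless[of "int p" "int q"] zdvd_not_zless[of "int p + 1" "int q"] by auto
  have small: "\<not> int q dvd k" if "0 < k" "k \<le> 2" for k
    using that assms zdvd_not_zless[of k "int q"] by auto
  have 4: "\<not> int q dvd 4" using small[of 2] prime_dvd_multD[OF q, of 2 2] by auto
  have "int q dvd 4 * int p * (int p + 1) * c\<^sup>2" unfolding eq by simp
  then have "int q dvd c"
    using ndvd 4 q by (auto simp: prime_dvd_mult_iff prime_dvd_power_iff)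
  then obtain e where "c = int q * e" by (elim dvdE)
  \<comment> \<open>\<open>c\<close> contributes \<open>q\<close> twice; after one factor is
    cancelled, the left side is still divisible by \<open>q\<close>, while the right side has lost
    its only such factor.\<close>
  then have "int q * (int q * (4 * int p * (int p + 1) * e\<^sup>2)) = int q * (4 * 4 * (int q + 1) * (4 * int q + 2)\<^sup>2)"
    using eq by (simp add: power2_eq_square algebra_simps)
  then have "int q * (4 * int p * (int p + 1) * e\<^sup>2) = 4 * 4 * (int q + 1) * (4 * int q + 2)\<^sup>2"
    using assms by (simp only: mult_cancel_left) simp
  then have "int q dvd 4 * 4 * (int q + 1) * (4 * int q + 2)\<^sup>2" by (metis dvd_triv_left)
  moreover have "\<not> int q dvd 16" using 4 prime_dvd_multD[OF q, of 4 4] by auto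
  ultimately have "int q dvd int q + 1 \<or> int q dvd 4 * int q + 2"
    using 4 q by (auto simp: prime_dvd_mult_iff prime_dvd_power_iff)
  \<comment> \<open>Modulo \<open>q\<close> the two remaining candidates are 1 and 2.\<close>
  then show False
    using small[of 1] small[of 2] by (auto simp: dvd_add_right_iff)
qed

section \<open>Pairwise inequivalence of the chosen elements\<close>

lemma hyperbolic_not_z_equivalent:
  assumes n: "2 \<le> n" and "prime p" "prime q" "2 < p" "p < q"
  shows "(hyperbolic n q, hyperbolic n p) \<notin> z_equivalence (palindromic_AutoGroup n)"
proof
  let ?G = "palindromic_AutoGroup n" and ?x = "hyperbolic n q" and ?y = "hyperbolic n p"
  interpret G: group ?G by (rule group_palindromic_AutoGroup)
  assume "(?x, ?y) \<in> z_equivalence ?G"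
  then obtain g where g: "g \<in> carrier ?G"
    and comm: "\<And>h. h \<in> centralizer ?G ?y \<Longrightarrow>
      h \<otimes>\<^bsub>?G\<^esub> (g \<otimes>\<^bsub>?G\<^esub> ?x \<otimes>\<^bsub>?G\<^esub> inv\<^bsub>?G\<^esub> g) = (g \<otimes>\<^bsub>?G\<^esub> ?x \<otimes>\<^bsub>?G\<^esub> inv\<^bsub>?G\<^esub> g) \<otimes>\<^bsub>?G\<^esub> h"
    using G.z_equivalent_conjugate_commutes by blast
  define b where "b = g \<otimes>\<^bsub>?G\<^esub> ?x \<otimes>\<^bsub>?G\<^esub> inv\<^bsub>?G\<^esub> g"
  \<comment> \<open>The diagonal of \<open>b\<close> beyond the block has unknown signs; in the
    square \<open>c\<close> they become 1, so that traces determine the discriminant of the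
    block.\<close>
  define c where "c = b \<otimes>\<^bsub>?G\<^esub> b"
  define x where "x = ?x \<otimes>\<^bsub>?G\<^esub> ?x"
  note hyp = hyperbolic_palindromic_auto[OF n] hyperbolic_commutes_with_inversions[OF n]
  have g': "g \<in> palindromic_auto n" using g by simp
  have "b \<in> carrier ?G" unfolding b_def using g hyp(1)[of q] G.m_closed G.inv_closed by simp
  then have bpal: "b \<in> palindromic_auto n" by simp
  have xpal: "x \<in> palindromic_auto n" unfolding x_def using times_closed[OF n] hyp(1) by blast
  \<comment> \<open>Two kinds of elements of the centralizer of \<open>?y\<close> are used: the
    inversions give \<open>b\<close> its block shape, and \<open>?y\<close> itself restricts the
    block.\<close>
  have "inversion n i \<in> centralizer ?G ?y" if "i \<in> {3..n}" for i
    using hyp(2)[of p] that inversion_palindromic_auto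
    by (auto simp: centralizer_def commutes_with_inversions_def[OF n])
  then have b: "b \<in> commutes_with_inversions n"
    using comm bpal by (auto simp: commutes_with_inversions_def[OF n] b_def)
  have "?y \<in> centralizer ?G ?y" using hyp(1) by (simp add: centralizer_def)
  then have yb: "?y \<otimes>\<^bsub>?G\<^esub> b = b \<otimes>\<^bsub>?G\<^esub> ?y" using comm by (simp add: b_def)
  have yc: "c \<otimes>\<^bsub>?G\<^esub> ?y = ?y \<otimes>\<^bsub>?G\<^esub> c"
    unfolding c_def using \<open>b \<in> carrier ?G\<close> hyp(1)[of p] yb
    by (metis G.m_assoc palindromic_AutoGroup_carrier)
  have c: "c \<in> commutes_with_inversions n" and x: "x \<in> commutes_with_inversions n"
    unfolding c_def x_def using commutes_with_inversions_times[OF n] b hyp(2) by blast+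
  have c1: "ab_matrix c i i = 1" and x1: "ab_matrix x i i = 1" if "i \<in> {3..n}" for i
    unfolding c_def x_def using commutes_with_inversions_diag_square[OF n _ that] b hyp(2) by blast+
  \<comment> \<open>\<open>c\<close> is conjugate to \<open>x\<close>, and likewise their squares,
    so both pairs of traces agree, and with them the discriminants.\<close>
  have c_conj: "c = g \<otimes>\<^bsub>?G\<^esub> x \<otimes>\<^bsub>?G\<^esub> inv\<^bsub>?G\<^esub> g"
    unfolding c_def b_def x_def using conjugate_square[OF n hyp(1) g'] .
  have "c \<otimes>\<^bsub>?G\<^esub> c = g \<otimes>\<^bsub>?G\<^esub> (x \<otimes>\<^bsub>?G\<^esub> x) \<otimes>\<^bsub>?G\<^esub> inv\<^bsub>?G\<^esub> g"
    unfolding c_conj using conjugate_square[OF n xpal g'] .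
  then have "ab_trace n (c \<otimes>\<^bsub>?G\<^esub> c) = ab_trace n (x \<otimes>\<^bsub>?G\<^esub> x)"
    using ab_trace_conjugate[OF times_closed[OF n xpal xpal] g'] by simp
  moreover have "ab_trace n c = ab_trace n x"
    unfolding c_conj using ab_trace_conjugate[OF xpal g'] .
  ultimately have "(ab_matrix c 1 1 - ab_matrix c 2 2)\<^sup>2 + 4 * ab_matrix c 1 2 * ab_matrix c 2 1
      = (ab_matrix x 1 1 - ab_matrix x 2 2)\<^sup>2 + 4 * ab_matrix x 1 2 * ab_matrix x 2 1"
    using discriminant_of_traces[OF n c c1] discriminant_of_traces[OF n x x1] by metis
  \<comment> \<open>The common discriminant is evaluated for \<open>c\<close> by commutation with
    \<open>?y\<close>, and for \<open>x\<close> directly.\<close>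
  then have "4 * int p * (int p + 1) * (ab_matrix c 1 2)\<^sup>2
      = 16 * int q * (int q + 1) * (4 * int q + 2)\<^sup>2"
    using discriminant_of_hyperbolic_centralizer[OF n c yc] hyperbolic_discriminant[OF n, of q]
    unfolding x_def by metis
  then show False using primes_discriminants_independent[OF assms(2-5)] by blast
qed

section \<open>Distinct z-classes indexed by the odd primes\<close>

theorem theorem1p2:
  fixes n :: nat
  assumes "n \<ge> 3"
  shows "infinite (z_classes (palindromic_AutoGroup n))"
proof
  let ?G = "palindromic_AutoGroup n"
  \<comment> \<open>Distinct primes above 2 differ by at least 2, as the arithmetic comparison
    requires.\<close>
  let ?P = "{p::nat. prime p \<and> 2 < p}"
  let ?class = "\<lambda>p. z_equivalence ?G `` {hyperbolic n p}"
  interpret group ?G by (rule group_palindromic_AutoGroup)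
  have n: "2 \<le> n" using assms by simp
  have hyp: "hyperbolic n p \<in> carrier ?G" for p
    using hyperbolic_palindromic_auto[OF n] by simp
  have "inj_on ?class ?P"
  proof (rule linorder_inj_onI')
    fix p q assume "p \<in> ?P" "q \<in> ?P" "p < q"
    then have "(hyperbolic n q, hyperbolic n p) \<notin> z_equivalence ?G"
      using hyperbolic_not_z_equivalent[OF n] by blast
    then show "?class p \<noteq> ?class q"
      using eq_equiv_class[OF _ equiv_z_equivalence hyp] by metis
  qed
  moreover assume "finite (z_classes ?G)"
  moreover have "?class ` ?P \<subseteq> z_classes ?G"
    unfolding z_classes_def using hyp by (auto intro: quotientI)
  ultimately have "finite ?P" using inj_on_finite by blast
  \<comment> \<open>Leaving out the primes up to 2 discards only finitely many.\<close>
  moreover have "{p::nat. prime p} \<subseteq> ?P \<union> {..2}" by auto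
  ultimately show False using primes_infinite finite_subset by blast
qed

end
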